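(* Let $n\geq 3$ and let $L_n$ be the line graph of an $n$-dimensional hypercube-like network. Then $L_n$ is $(2n-4)$-edge-fault-tolerant strongly Menger edge connected. Further, if $k>2n-4$, then $L_n$ is not $k$-edge-fault-tolerant strongly Menger edge connected.
   Context: For two disjoint graphs $G_1,G_2$ with the same number of vertices and a bijection $f:V(G_1)\to V(G_2)$, $G_1\oplus_f G_2$ denotes the graph obtained from $G_1\cup G_2$ by adding the edges $(v,f(v))$ for all $v\in V(G_1)$. The $n$-dimensional hypercube-like networks are defined recursively: $K_2$ is the only $1$-dimensional hypercube-like network; for $n\geq 2$, if $Q^1_{n-1}$ and $Q^2_{n-1}$ are (disjoint) $(n-1)$-dimensional hypercube-like networks, then $Q^1_{n-1}\oplus_f Q^2_{n-1}$ is an $n$-dimensional hypercube-like network for every bijection $f:V(Q^1_{n-1})\to V(Q^2_{n-1})$. The line graph $L(G)$ of a graph $G$ has vertex set $E(G)$, two vertices being adjacent iff the corresponding edges share an end-vertex. A connected graph $G$ is strongly Menger edge connected if for any two distinct vertices $u,v$ of $G$ there are $\min\{\deg_G(u),\deg_G(v)\}$ edge-disjoint $(u,v)$-paths in $G$. For a positive integer $m$, a connected graph $G$ is $m$-edge-fault-tolerant strongly Menger edge connected if $G-F$ is strongly Menger edge connected for every edge set $F\subseteq E(G)$ with $|F|\leq m$ (degrees being taken in $G-F$). *)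

theory Defs
  imports Main
begin

record 'a ugraph =
  verts :: "'a set"
  edges :: "'a set set"

definition upath :: "'a ugraph \<Rightarrow> 'a \<Rightarrow> 'a \<Rightarrow> 'a list \<Rightarrow> bool" where
  "upath G u v p \<longleftrightarrow>
     p \<noteq> [] \<and> hd p = u \<and> last p = v \<and> distinct p \<and> set p \<subseteq> verts G \<and>
     (\<forall>i. Suc i < length p \<longrightarrow> {p ! i, p ! Suc i} \<in> edges G)"

definition path_edges :: "'a list \<Rightarrow> 'a set set" where
  "path_edges p = {{p ! i, p ! Suc i} | i. Suc i < length p}"

definition edge_disjoint_paths :: "'a ugraph \<Rightarrow> 'a \<Rightarrow> 'a \<Rightarrow> nat \<Rightarrow> bool" where
  "edge_disjoint_paths G u v k \<longleftrightarrow>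
     (\<exists>P. finite P \<and> card P = k \<and> (\<forall>p\<in>P. upath G u v p) \<and>
          pairwise (\<lambda>p q. path_edges p \<inter> path_edges q = {}) P)"

definition connected_graph :: "'a ugraph \<Rightarrow> bool" where
  "connected_graph G \<longleftrightarrow>
     verts G \<noteq> {} \<and> (\<forall>u\<in>verts G. \<forall>v\<in>verts G. \<exists>p. upath G u v p)"

definition deg :: "'a ugraph \<Rightarrow> 'a \<Rightarrow> nat" where
  "deg G v = card {e \<in> edges G. v \<in> e}"

definition delete_edges :: "'a ugraph \<Rightarrow> 'a set set \<Rightarrow> 'a ugraph" where
  "delete_edges G F = \<lparr>verts = verts G, edges = edges G - F\<rparr>"

definition line_graph :: "'a ugraph \<Rightarrow> 'a set ugraph" where
  "line_graph G =
     \<lparr>verts = edges G,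
      edges = {{e, e'} | e e'. e \<in> edges G \<and> e' \<in> edges G \<and> e \<noteq> e' \<and> e \<inter> e' \<noteq> {}}\<rparr>"

definition join_by :: "'a ugraph \<Rightarrow> ('a \<Rightarrow> 'a) \<Rightarrow> 'a ugraph \<Rightarrow> 'a ugraph" where
  "join_by G\<^sub>1 f G\<^sub>2 =
     \<lparr>verts = verts G\<^sub>1 \<union> verts G\<^sub>2,
      edges = edges G\<^sub>1 \<union> edges G\<^sub>2 \<union> {{v, f v} | v. v \<in> verts G\<^sub>1}\<rparr>"

text \<open>Both halves live on disjoint subsets of one type, and \<open>K\<^sub>2\<close> may sit on any two
  distinct points, so the class is closed under isomorphism. The predicate never holds in
  dimension 0.\<close>

inductive hypercube_like :: "nat \<Rightarrow> 'a ugraph \<Rightarrow> bool" where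
  K2: "a \<noteq> b \<Longrightarrow> hypercube_like 1 \<lparr>verts = {a, b}, edges = {{a, b}}\<rparr>"
| join: "\<lbrakk>hypercube_like n Q\<^sub>1; hypercube_like n Q\<^sub>2; verts Q\<^sub>1 \<inter> verts Q\<^sub>2 = {};
          bij_betw f (verts Q\<^sub>1) (verts Q\<^sub>2)\<rbrakk>
         \<Longrightarrow> hypercube_like (Suc n) (join_by Q\<^sub>1 f Q\<^sub>2)"

definition strongly_Menger_edge_connected :: "'a ugraph \<Rightarrow> bool" where
  "strongly_Menger_edge_connected G \<longleftrightarrow>
     connected_graph G \<and>
     (\<forall>u\<in>verts G. \<forall>v\<in>verts G. u \<noteq> v \<longrightarrow>
        edge_disjoint_paths G u v (min (deg G u) (deg G v)))"

text \<open>The notion is customarily used for positive \<open>m\<close> only; the finiteness of \<open>F\<close> is explicit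
  because an infinite set has \<open>card\<close> 0.\<close>

definition edge_fault_tolerant_strongly_Menger :: "nat \<Rightarrow> 'a ugraph \<Rightarrow> bool" where
  "edge_fault_tolerant_strongly_Menger m G \<longleftrightarrow>
     connected_graph G \<and>
     (\<forall>F. F \<subseteq> edges G \<and> finite F \<and> card F \<le> m \<longrightarrow>
        strongly_Menger_edge_connected (delete_edges G F))"

end

theory Submission
  imports Defs "HOL-Library.Transitive_Closure_Table"
begin

text \<open>
  By Menger's theorem for edges it suffices to bound cuts. A set \<open>X\<close> of edges of an \<open>n\<close>-regular
  graph meeting a vertex \<open>w\<close> in \<open>x\<^sub>w\<close> edges has \<open>\<Sum>w. x\<^sub>w (n - x\<^sub>w)\<close> cut edges in the line graph.
  Only the vertices with \<open>0 < x\<^sub>w < n\<close> contribute, and if the graph is \<open>n\<close>-connected, fewer than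
  \<open>n\<close> such vertices force \<open>X\<close> or its complement to live on them. Hence every cut with at least two
  vertices on each side has at least \<open>4n - 6 = (2n - 4) + (2n - 2)\<close> edges, so that after
  \<open>2n - 4\<close> faults only the cuts around single vertices can be smaller than \<open>2n - 2\<close>. Conversely,
  let \<open>u\<close> and \<open>w\<close> be adjacent in the line graph and delete all edges at \<open>w\<close> except \<open>{u, w}\<close>.
  Then \<open>u\<close> keeps its degree \<open>2n - 2\<close>, but the cut around \<open>{u, w}\<close> has only \<open>2n - 3\<close> edges.
\<close>

subsection \<open>Finite simple graphs and edge cuts\<close>

definition wf_graph :: "'a ugraph \<Rightarrow> bool" where
  "wf_graph G \<longleftrightarrow> finite (verts G) \<and> (\<forall>e\<in>edges G. e \<subseteq> verts G \<and> card e = 2)"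

abbreviation incident :: "'a set set \<Rightarrow> 'a \<Rightarrow> 'a set set" where
  "incident E v \<equiv> {e \<in> E. v \<in> e}"

definition regular :: "nat \<Rightarrow> 'a ugraph \<Rightarrow> bool" where
  "regular d G \<longleftrightarrow> (\<forall>v\<in>verts G. deg G v = d)"

definition edge_cut :: "'a ugraph \<Rightarrow> 'a set \<Rightarrow> 'a set set" where
  "edge_cut G X = {e \<in> edges G. e \<inter> X \<noteq> {} \<and> \<not> e \<subseteq> X}"

lemma wf_graph_finite_edges: "wf_graph G \<Longrightarrow> finite (edges G)"
  unfolding wf_graph_def by (metis PowI finite_Pow_iff finite_subset subsetI)

lemma wf_graph_edgeD:
  assumes "wf_graph G" "{x, y} \<in> edges G"
  shows "x \<in> verts G" "y \<in> verts G" "x \<noteq> y"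
  using assms unfolding wf_graph_def by fastforce+

lemma wf_graph_edgeE:
  assumes "wf_graph G" "e \<in> edges G" "x \<in> e"
  obtains y where "e = {x, y}" "x \<noteq> y"
  using assms that unfolding wf_graph_def card_2_iff by (metis doubleton_eq_iff insertE singletonD)

lemma card_incident_less:
  assumes "finite V" "v \<in> V" "\<And>e. e \<in> E \<Longrightarrow> v \<in> e \<Longrightarrow> e \<subseteq> V \<and> card e = 2"
  shows "card (incident E v) < card V"
proof -
  have "incident E v \<subseteq> (\<lambda>x. {v, x}) ` (V - {v})"
  proof
    fix e assume "e \<in> incident E v"
    with assms(3) have "v \<in> e" "e \<subseteq> V" "card e = 2" by auto
    then show "e \<in> (\<lambda>x. {v, x}) ` (V - {v})"
      by (auto simp: card_2_iff)
  qed
  then have "card (incident E v) \<le> card (V - {v})"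
    using assms(1) by (intro surj_card_le) auto
  also have "\<dots> < card V"
    using assms by (intro card_Diff1_less)
  finally show ?thesis .
qed

lemma deg_less_card_verts:
  assumes "wf_graph G" "v \<in> verts G"
  shows "deg G v < card (verts G)"
  unfolding deg_def using assms by (intro card_incident_less) (auto simp: wf_graph_def)

lemma regular_incident_edge:
  assumes "regular d G" "d \<noteq> 0" "v \<in> verts G"
  obtains e where "e \<in> edges G" "v \<in> e"
proof -
  have "card (incident (edges G) v) \<noteq> 0"
    using assms by (simp add: regular_def deg_def)
  then obtain e where "e \<in> incident (edges G) v"
    by (metis card.empty ex_in_conv)
  with that show ?thesis by blast
qed

lemma finite_edge_cut: "wf_graph G \<Longrightarrow> finite (edge_cut G X)"
  by (simp add: edge_cut_def wf_graph_finite_edges)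

lemma card_edge_cut_singleton:
  assumes "wf_graph G"
  shows "card (edge_cut G {v}) = deg G v"
proof -
  have "\<not> e \<subseteq> {v}" if "e \<in> edges G" for e
    using assms that card_mono[of "{v}" e] by (fastforce simp: wf_graph_def)
  then have "edge_cut G {v} = incident (edges G) v"
    by (auto simp: edge_cut_def)
  then show ?thesis
    by (simp add: deg_def)
qed

lemma edge_cut_complement:
  assumes "wf_graph G" "X \<subseteq> verts G"
  shows "edge_cut G (verts G - X) = edge_cut G X"
  using assms unfolding wf_graph_def edge_cut_def by blast

lemma card_edge_cut:
  assumes "wf_graph G" "X \<subseteq> verts G"
  shows "card (edge_cut G X) = (\<Sum>x\<in>X. \<Sum>y\<in>verts G - X. of_bool ({x, y} \<in> edges G))"
proof -
  have fin: "finite (X \<times> (verts G - X))"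
    using assms finite_subset by (auto simp: wf_graph_def)
  define C where "C = X \<times> (verts G - X) \<inter> {(x, y). {x, y} \<in> edges G}"
  have "inj_on (\<lambda>(x, y). {x, y}) C"
    by (auto simp: inj_on_def C_def doubleton_eq_iff)
  moreover have "(\<lambda>(x, y). {x, y}) ` C = edge_cut G X"
  proof
    show "(\<lambda>(x, y). {x, y}) ` C \<subseteq> edge_cut G X"
      by (auto simp: C_def edge_cut_def)
    show "edge_cut G X \<subseteq> (\<lambda>(x, y). {x, y}) ` C"
    proof
      fix e assume e: "e \<in> edge_cut G X"
      then obtain x where "x \<in> e" "x \<in> X" and "e \<in> edges G" "\<not> e \<subseteq> X"
        by (auto simp: edge_cut_def)
      then obtain y where "e = {x, y}" "y \<notin> X"
        using wf_graph_edgeE[OF assms(1)] by (metis empty_subsetI insert_subset)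
      with \<open>e \<in> edges G\<close> \<open>x \<in> X\<close> have "(x, y) \<in> C"
        using wf_graph_edgeD[OF assms(1)] by (auto simp: C_def)
      with \<open>e = {x, y}\<close> show "e \<in> (\<lambda>(x, y). {x, y}) ` C" by auto
    qed
  qed
  ultimately have "card (edge_cut G X) = card C"
    by (metis card_image)
  also have "\<dots> = (\<Sum>(x, y)\<in>X \<times> (verts G - X). of_bool ({x, y} \<in> edges G))"
    using fin by (simp add: C_def case_prod_unfold)
  finally show ?thesis
    by (simp add: sum.cartesian_product)
qed

subsection \<open>Menger's theorem for edges\<close>

definition path_arcs :: "'a list \<Rightarrow> ('a \<times> 'a) set" where
  "path_arcs p = set (zip p (tl p))"

lemma path_arcs_simps [simp]:
  "path_arcs [] = {}" "path_arcs [x] = {}"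
  "path_arcs (x # y # p) = insert (x, y) (path_arcs (y # p))"
  by (simp_all add: path_arcs_def)

lemma path_arcs_subset: "path_arcs p \<subseteq> set p \<times> set p"
  by (induction p rule: induct_list012) auto

lemma path_arcs_nth: "path_arcs p = {(p ! i, p ! Suc i) | i. Suc i < length p}"
  by (cases p) (auto simp: path_arcs_def set_zip)

lemma path_edges_path_arcs: "path_edges p = (\<lambda>(x, y). {x, y}) ` path_arcs p"
  unfolding path_edges_def path_arcs_nth by force

lemma upath_iff_path_arcs:
  "upath G u v p \<longleftrightarrow> p \<noteq> [] \<and> hd p = u \<and> last p = v \<and> distinct p \<and> set p \<subseteq> verts G \<and>
    (\<forall>(x, y)\<in>path_arcs p. {x, y} \<in> edges G)"
  unfolding upath_def path_arcs_nth by auto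

lemma path_arcs_leave:
  assumes "p \<noteq> []" "hd p \<in> X" "last p \<notin> X"
  shows "\<exists>x\<in>X. \<exists>y\<in>- X. (x, y) \<in> path_arcs p"
  using assms by (induction p rule: induct_list012) auto

lemma edge_disjoint_paths_le_edge_cut:
  assumes "wf_graph G" "edge_disjoint_paths G u v k" "u \<in> X" "v \<notin> X"
  shows "k \<le> card (edge_cut G X)"
proof -
  obtain P where P: "card P = k" "\<And>p. p \<in> P \<Longrightarrow> upath G u v p"
    and disj: "pairwise (\<lambda>p q. path_edges p \<inter> path_edges q = {}) P"
    using assms(2) unfolding edge_disjoint_paths_def by blast
  have "\<exists>e. e \<in> path_edges p \<inter> edge_cut G X" if "p \<in> P" for p
  proof -
    obtain x y where "x \<in> X" "y \<notin> X" "(x, y) \<in> path_arcs p"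
      using path_arcs_leave[of p X] P(2)[OF \<open>p \<in> P\<close>] assms(3,4)
      by (auto simp: upath_iff_path_arcs)
    then have "{x, y} \<in> path_edges p \<inter> edge_cut G X"
      using P(2)[OF \<open>p \<in> P\<close>] by (force simp: upath_iff_path_arcs path_edges_path_arcs edge_cut_def)
    then show ?thesis ..
  qed
  then obtain crossing where
    crossing: "\<And>p. p \<in> P \<Longrightarrow> crossing p \<in> path_edges p \<inter> edge_cut G X"
    by metis
  then have "inj_on crossing P"
    using disj unfolding inj_on_def pairwise_def by (metis IntE IntI emptyE)
  then show ?thesis
    using P(1) crossing finite_edge_cut[OF assms(1)] card_inj_on_le[of crossing P] by blast
qed

lemma upath_or_closed_set:
  assumes wf: "wf_graph G" and s: "s \<in> verts G" and r: "\<And>x y. r x y \<Longrightarrow> {x, y} \<in> edges G"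
  obtains p where "upath G s t p" "\<And>x y. (x, y) \<in> path_arcs p \<Longrightarrow> r x y"
  | X where "X \<subseteq> verts G" "s \<in> X" "t \<notin> X"
      "\<And>x y. x \<in> X \<Longrightarrow> y \<notin> X \<Longrightarrow> \<not> r x y"
proof (cases "r\<^sup>*\<^sup>* s t")
  case True
  then obtain xs where xs: "rtrancl_path r s xs t" "distinct (s # xs)"
    by (metis rtranclp_eq_rtrancl_path rtrancl_path_distinct)
  have arcs: "r x y" if "(x, y) \<in> path_arcs (s # xs)" for x y
    using that rtrancl_path_nth[OF xs(1)] by (auto simp: path_arcs_nth)
  have "set xs \<subseteq> verts G"
    using rtrancl_path_nth[OF xs(1)] r wf_graph_edgeD(2)[OF wf] by (metis in_set_conv_nth subsetI)
  moreover have "last (s # xs) = t"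
    using xs(1) by (cases xs) (auto dest: rtrancl_path_last elim: rtrancl_path.cases)
  ultimately have "upath G s t (s # xs)"
    using xs(2) s arcs r by (auto simp: upath_iff_path_arcs)
  then show ?thesis
    using arcs by (rule that(1))
next
  case False
  have "x \<in> verts G" if "r\<^sup>*\<^sup>* s x" for x
    using that s r wf_graph_edgeD(2)[OF wf] by (induction rule: rtranclp_induct) auto
  then show ?thesis
    using False by (intro that(2)[of "{x. r\<^sup>*\<^sup>* s x}"]) (auto intro: rtranclp.rtrancl_into_rtrancl)
qed

definition net_flow :: "'a ugraph \<Rightarrow> ('a \<Rightarrow> 'a \<Rightarrow> int) \<Rightarrow> 'a \<Rightarrow> int" where
  "net_flow G f x = (\<Sum>y\<in>verts G. f x y)"

definition unit_flow :: "'a ugraph \<Rightarrow> 'a \<Rightarrow> 'a \<Rightarrow> int \<Rightarrow> ('a \<Rightarrow> 'a \<Rightarrow> int) \<Rightarrow> bool" where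
  "unit_flow G s t j f \<longleftrightarrow>
     (\<forall>x y. f y x = - f x y) \<and> (\<forall>x y. f x y \<le> 1) \<and> (\<forall>x y. f x y \<noteq> 0 \<longrightarrow> {x, y} \<in> edges G) \<and>
     (\<forall>x\<in>verts G. net_flow G f x = j * (of_bool (s = x) - of_bool (t = x)))"

definition path_flow :: "'a list \<Rightarrow> 'a \<Rightarrow> 'a \<Rightarrow> int" where
  "path_flow p x y = of_bool ((x, y) \<in> path_arcs p) - of_bool ((y, x) \<in> path_arcs p)"

lemma unit_flowD:
  assumes "unit_flow G s t j f"
  shows "f y x = - f x y" "f x y \<le> 1" "f x y \<noteq> 0 \<Longrightarrow> {x, y} \<in> edges G"
    "x \<in> verts G \<Longrightarrow> net_flow G f x = j * (of_bool (s = x) - of_bool (t = x))"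
  using assms unfolding unit_flow_def by metis+

lemma unit_flow_zero: "unit_flow G s t 0 (\<lambda>_ _. 0)"
  by (simp add: unit_flow_def net_flow_def)

lemma unit_flow_add:
  assumes f: "unit_flow G s t i f" and g: "unit_flow G s t j g"
    and capacity: "\<And>x y. f x y + g x y \<le> 1"
  shows "unit_flow G s t (i + j) (\<lambda>x y. f x y + g x y)"
  unfolding unit_flow_def
proof (intro conjI allI ballI impI)
  fix x y
  show "f y x + g y x = - (f x y + g x y)"
    using unit_flowD(1)[OF f, of y x] unit_flowD(1)[OF g, of y x] by linarith
  show "f x y + g x y \<le> 1"
    by (rule capacity)
  show "{x, y} \<in> edges G" if "f x y + g x y \<noteq> 0"
    using that unit_flowD(3)[OF f, of x y] unit_flowD(3)[OF g, of x y]
    by (cases "f x y = 0") simp_all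
  assume x: "x \<in> verts G"
  have "net_flow G (\<lambda>x y. f x y + g x y) x = net_flow G f x + net_flow G g x"
    by (simp add: net_flow_def sum.distrib)
  then show "net_flow G (\<lambda>x y. f x y + g x y) x = (i + j) * (of_bool (s = x) - of_bool (t = x))"
    by (simp only: unit_flowD(4)[OF f x] unit_flowD(4)[OF g x] distrib_right)
qed

lemma unit_flow_uminus:
  assumes f: "unit_flow G s t j f"
  shows "unit_flow G s t (- j) (\<lambda>x y. - f x y)"
  unfolding unit_flow_def
proof (intro conjI allI ballI impI)
  fix x y
  show "- f y x = - (- f x y)" "- f x y \<le> 1"
    using unit_flowD(1)[OF f, of y x] unit_flowD(2)[OF f, of y x] by linarith+
  show "{x, y} \<in> edges G" if "- f x y \<noteq> 0"
    using that unit_flowD(3)[OF f, of x y] by simp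
  assume x: "x \<in> verts G"
  have "net_flow G (\<lambda>x y. - f x y) x = - net_flow G f x"
    by (simp add: net_flow_def sum_negf)
  then show "net_flow G (\<lambda>x y. - f x y) x = - j * (of_bool (s = x) - of_bool (t = x))"
    by (simp only: unit_flowD(4)[OF f x] mult_minus_left)
qed

lemma net_flow_path_flow:
  assumes "finite (verts G)" "p \<noteq> []" "distinct p" "set p \<subseteq> verts G"
  shows "net_flow G (path_flow p) x = of_bool (hd p = x) - of_bool (last p = x)"
  using assms(2-)
proof (induction p rule: induct_list012)
  case (3 a b p)
  have fresh: "(a, b) \<notin> path_arcs (b # p)"
    using 3 path_arcs_subset[of "b # p"] by auto
  have "of_bool ((x, y) \<in> path_arcs (a # b # p)) =
      of_bool (a = x) * of_bool (y = b) + (of_bool ((x, y) \<in> path_arcs (b # p)) :: int)" for x y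
    using fresh by (cases "a = x"; cases "y = b") auto
  then have "path_flow (a # b # p) x y = path_flow (b # p) x y +
      (of_bool (a = x) * of_bool (y = b) - of_bool (b = x) * of_bool (y = a))" for y
    by (simp only: path_flow_def) simp
  moreover have "(\<Sum>y\<in>verts G. of_bool (c = x) * of_bool (y = d)) = (of_bool (c = x) :: int)"
    if "d \<in> verts G" for c d
    using assms(1) that by simp
  ultimately have "net_flow G (path_flow (a # b # p)) x =
      of_bool (a = x) - of_bool (b = x) + net_flow G (path_flow (b # p)) x"
    using 3(5) by (simp only: net_flow_def sum.distrib sum_subtractf) simp
  with 3 show ?case by simp
qed (simp_all add: net_flow_def path_flow_def)

lemma unit_flow_path:
  assumes "wf_graph G" "upath G s t p"
  shows "unit_flow G s t 1 (path_flow p)"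
  unfolding unit_flow_def
proof (intro conjI allI ballI impI)
  fix x y
  show "path_flow p y x = - path_flow p x y" "path_flow p x y \<le> 1"
    by (simp_all add: path_flow_def)
  show "net_flow G (path_flow p) x = 1 * (of_bool (s = x) - of_bool (t = x))"
    using net_flow_path_flow[of G p x] assms by (auto simp: upath_def wf_graph_def)
  assume "path_flow p x y \<noteq> 0"
  then have "(x, y) \<in> path_arcs p \<or> (y, x) \<in> path_arcs p"
    by (auto simp: path_flow_def)
  then show "{x, y} \<in> edges G"
    using assms(2) by (auto simp: upath_iff_path_arcs insert_commute)
qed

lemma unit_flow_remove_path:
  assumes wf: "wf_graph G" and f: "unit_flow G s t j f" and p: "upath G s t p"
    and positive: "\<And>x y. (x, y) \<in> path_arcs p \<Longrightarrow> 0 < f x y"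
  shows "unit_flow G s t (j - 1) (\<lambda>x y. f x y - path_flow p x y)"
proof -
  have "f x y + - path_flow p x y \<le> 1" for x y
    using positive[of y x] unit_flowD(1)[OF f, of y x] unit_flowD(2)[OF f, of x y]
    by (cases "(y, x) \<in> path_arcs p") (simp_all add: path_flow_def)
  from unit_flow_add[OF f unit_flow_uminus[OF unit_flow_path[OF wf p]] this] show ?thesis
    by simp
qed

lemma positive_after_remove_path:
  assumes f: "unit_flow G s t j f" and "0 < f x y - path_flow p x y"
    and positive: "\<And>x y. (x, y) \<in> path_arcs p \<Longrightarrow> 0 < f x y"
  shows "0 < f x y" "(x, y) \<notin> path_arcs p" "(y, x) \<notin> path_arcs p"
  using assms(2) positive[of x y] positive[of y x] unit_flowD(1)[OF f, of y x]
    unit_flowD(2)[OF f, of x y]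
  by (cases "(x, y) \<in> path_arcs p"; cases "(y, x) \<in> path_arcs p"; simp add: path_flow_def)+

lemma unit_flow_across:
  assumes "wf_graph G" "unit_flow G s t j f" "X \<subseteq> verts G" "s \<in> X" "t \<notin> X"
  shows "j = (\<Sum>x\<in>X. \<Sum>y\<in>verts G - X. f x y)"
proof -
  have fin: "finite X" "finite (verts G)"
    using assms finite_subset by (auto simp: wf_graph_def)
  have "(\<Sum>x\<in>X. \<Sum>y\<in>X. f x y) = (\<Sum>x\<in>X. \<Sum>y\<in>X. - f x y)"
    by (subst sum.swap) (simp flip: unit_flowD(1)[OF assms(2)])
  then have inner: "(\<Sum>x\<in>X. \<Sum>y\<in>X. f x y) = 0"
    by (simp add: sum_negf)
  have "j = (\<Sum>x\<in>X. j * of_bool (s = x))"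
    using fin assms(4) by (simp flip: sum_distrib_left)
  also have "\<dots> = (\<Sum>x\<in>X. net_flow G f x)"
    using assms by (intro sum.cong) (auto simp: unit_flowD(4)[OF assms(2)])
  also have "\<dots> = (\<Sum>x\<in>X. (\<Sum>y\<in>verts G - X. f x y) + (\<Sum>y\<in>X. f x y))"
    unfolding net_flow_def by (intro sum.cong sum.subset_diff fin assms(3) refl)
  also have "\<dots> = (\<Sum>x\<in>X. \<Sum>y\<in>verts G - X. f x y)"
    using inner by (simp add: sum.distrib)
  finally show ?thesis .
qed

lemma unit_flow_augment:
  assumes wf: "wf_graph G" and s: "s \<in> verts G" and f: "unit_flow G s t (int j) f"
    and cut: "\<And>X. X \<subseteq> verts G \<Longrightarrow> s \<in> X \<Longrightarrow> t \<notin> X \<Longrightarrow> j < card (edge_cut G X)"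
  shows "\<exists>f. unit_flow G s t (int (Suc j)) f"
proof -
  define residual where "residual x y \<longleftrightarrow> {x, y} \<in> edges G \<and> f x y \<le> 0" for x y
  have "\<And>x y. residual x y \<Longrightarrow> {x, y} \<in> edges G" by (simp add: residual_def)
  then consider (path) p where "upath G s t p" "\<And>x y. (x, y) \<in> path_arcs p \<Longrightarrow> residual x y"
    | (closed_set) X where "X \<subseteq> verts G" "s \<in> X" "t \<notin> X"
        "\<And>x y. x \<in> X \<Longrightarrow> y \<notin> X \<Longrightarrow> \<not> residual x y"
    using upath_or_closed_set[OF wf s] by metis
  then show ?thesis
  proof cases
    case (path p)
    have "f x y + path_flow p x y \<le> 1" for x y
      using path(2)[of x y] unit_flowD(2)[OF f, of x y] by (auto simp: path_flow_def residual_def)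
    then have "unit_flow G s t (int j + 1) (\<lambda>x y. f x y + path_flow p x y)"
      by (rule unit_flow_add[OF f unit_flow_path[OF wf path(1)]])
    then show ?thesis
      by (metis add.commute of_nat_Suc)
  next
    case (closed_set X)
    have saturated: "f x y = of_bool ({x, y} \<in> edges G)" if "x \<in> X" "y \<notin> X" for x y
      using closed_set(4)[OF that] unit_flowD(2,3)[OF f, of x y] by (auto simp: residual_def)
    have "int j = (\<Sum>x\<in>X. \<Sum>y\<in>verts G - X. f x y)"
      using unit_flow_across[OF wf f closed_set(1-3)] .
    also have "\<dots> = (\<Sum>x\<in>X. \<Sum>y\<in>verts G - X. of_bool ({x, y} \<in> edges G))"
      using saturated by (intro sum.cong) auto
    also have "\<dots> = int (card (edge_cut G X))"
      using card_edge_cut[OF wf closed_set(1)] by simp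
    finally show ?thesis
      using cut[OF closed_set(1-3)] by simp
  qed
qed

lemma unit_flow_positive_path:
  assumes wf: "wf_graph G" and s: "s \<in> verts G" and f: "unit_flow G s t j f" and "0 < j"
  obtains p where "upath G s t p" "\<And>x y. (x, y) \<in> path_arcs p \<Longrightarrow> 0 < f x y"
proof -
  have "\<And>x y. 0 < f x y \<Longrightarrow> {x, y} \<in> edges G"
    using unit_flowD(3)[OF f] by force
  then consider (path) p where "upath G s t p" "\<And>x y. (x, y) \<in> path_arcs p \<Longrightarrow> 0 < f x y"
    | (closed_set) X where "X \<subseteq> verts G" "s \<in> X" "t \<notin> X"
        "\<And>x y. x \<in> X \<Longrightarrow> y \<notin> X \<Longrightarrow> \<not> 0 < f x y"
    using upath_or_closed_set[OF wf s, of "\<lambda>x y. 0 < f x y"] by metis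
  then show ?thesis
  proof cases
    case (path p)
    then show ?thesis by (rule that)
  next
    case (closed_set X)
    have "j = (\<Sum>x\<in>X. \<Sum>y\<in>verts G - X. f x y)"
      using unit_flow_across[OF wf f closed_set(1-3)] .
    also have "\<dots> \<le> 0"
      using closed_set(4) by (intro sum_nonpos) (auto simp: not_less)
    finally show ?thesis
      using \<open>0 < j\<close> by simp
  qed
qed

lemma unit_flow_decompose:
  assumes wf: "wf_graph G" and st: "s \<in> verts G" "s \<noteq> t" and "unit_flow G s t (int j) f"
  shows "\<exists>P. finite P \<and> card P = j \<and> pairwise (\<lambda>p q. path_edges p \<inter> path_edges q = {}) P \<and>
    (\<forall>p\<in>P. upath G s t p \<and> (\<forall>(x, y)\<in>path_arcs p. 0 < f x y))"
  using assms(4)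
proof (induction j arbitrary: f)
  case 0
  show ?case by (rule exI[of _ "{}"]) (simp add: pairwise_def)
next
  case (Suc j)
  obtain p where p: "upath G s t p" and positive: "\<And>x y. (x, y) \<in> path_arcs p \<Longrightarrow> 0 < f x y"
    using unit_flow_positive_path[OF wf st(1) Suc.prems] by auto
  define g where "g x y = f x y - path_flow p x y" for x y
  have "unit_flow G s t (int j) g"
    unfolding g_def using unit_flow_remove_path[OF wf Suc.prems p positive] by simp
  from Suc.IH[OF this] obtain P where P: "finite P" "card P = j"
    "pairwise (\<lambda>p q. path_edges p \<inter> path_edges q = {}) P"
    "\<And>q. q \<in> P \<Longrightarrow> upath G s t q" "\<And>q x y. q \<in> P \<Longrightarrow> (x, y) \<in> path_arcs q \<Longrightarrow> 0 < g x y"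
    by blast
  have unused: "0 < f x y \<and> (x, y) \<notin> path_arcs p \<and> (y, x) \<notin> path_arcs p" if "0 < g x y" for x y
    using positive_after_remove_path[OF Suc.prems that[unfolded g_def] positive] by blast
  have disj: "path_edges p \<inter> path_edges q = {}" if "q \<in> P" for q
    using P(5)[OF that] unused by (auto simp: path_edges_path_arcs doubleton_eq_iff)
  moreover have "path_edges p \<noteq> {}"
    using path_arcs_leave[of p "{s}"] p st(2) by (auto simp: upath_def path_edges_path_arcs)
  ultimately have "p \<notin> P" by blast
  then have "card (insert p P) = Suc j"
    using P by simp
  moreover have "pairwise (\<lambda>p q. path_edges p \<inter> path_edges q = {}) (insert p P)"
    using P(3) disj by (auto simp: pairwise_insert Int_commute)
  moreover have "\<forall>q\<in>insert p P. upath G s t q \<and> (\<forall>(x, y)\<in>path_arcs q. 0 < f x y)"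
    using p positive P(4,5) unused by blast
  ultimately show ?case
    using P(1) by (intro exI[of _ "insert p P"]) blast
qed

theorem edge_Menger:
  assumes wf: "wf_graph G" and st: "s \<in> verts G" "s \<noteq> t"
    and cut: "\<And>X. X \<subseteq> verts G \<Longrightarrow> s \<in> X \<Longrightarrow> t \<notin> X \<Longrightarrow> k \<le> card (edge_cut G X)"
  shows "edge_disjoint_paths G s t k"
proof -
  have "\<exists>f. unit_flow G s t (int j) f" if "j \<le> k" for j
    using that
  proof (induction j)
    case 0
    show ?case
      by (rule exI[of _ "\<lambda>_ _. 0"]) (simp add: unit_flow_zero)
  next
    case (Suc j)
    then obtain f where "unit_flow G s t (int j) f" by auto
    then show ?case
      using Suc.prems cut unfolding Suc_le_eq
      by (intro unit_flow_augment[OF wf st(1)]) (auto intro: less_le_trans)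
  qed
  then obtain f where "unit_flow G s t (int k) f" by blast
  from unit_flow_decompose[OF wf st this] show ?thesis
    unfolding edge_disjoint_paths_def by blast
qed

subsection \<open>Edge faults in regular graphs\<close>

lemma delete_edges_simps [simp]:
  "verts (delete_edges G F) = verts G" "edges (delete_edges G F) = edges G - F"
  by (simp_all add: delete_edges_def)

lemma wf_graph_delete_edges: "wf_graph G \<Longrightarrow> wf_graph (delete_edges G F)"
  by (simp add: wf_graph_def)

lemma edge_cut_delete_edges: "edge_cut (delete_edges G F) X = edge_cut G X - F"
  by (auto simp: edge_cut_def)

lemma deg_delete_edges_at_neighbour:
  assumes wf: "wf_graph G" and F: "F \<subseteq> incident (edges G) w" and z: "z \<noteq> w" "{z, w} \<notin> F"
  shows "deg (delete_edges G F) z = deg G z"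
proof -
  have "z \<notin> e" if "e \<in> F" for e
  proof
    assume "z \<in> e"
    obtain y where "e = {w, y}"
      using wf_graph_edgeE[OF wf, of e w] \<open>e \<in> F\<close> F by auto
    with \<open>z \<in> e\<close> z(1) have "e = {z, w}" by blast
    with \<open>e \<in> F\<close> z(2) show False by blast
  qed
  then have "incident (edges G - F) z = incident (edges G) z" by blast
  then show ?thesis by (simp add: deg_def)
qed

lemma min_deg_le_edge_cut:
  assumes wf: "wf_graph G" and X: "X \<subseteq> verts G" "u \<in> X" "v \<in> verts G - X"
    and deg_le: "deg G u \<le> d"
    and cuts: "2 \<le> card X \<Longrightarrow> 2 \<le> card (verts G - X) \<Longrightarrow> d \<le> card (edge_cut G X)"
  shows "min (deg G u) (deg G v) \<le> card (edge_cut G X)"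
proof -
  have fin: "finite X" "finite (verts G - X)"
    using wf X(1) finite_subset by (auto simp: wf_graph_def)
  consider (source) "X = {u}" | (target) "verts G - X = {v}"
    | (nontrivial) "2 \<le> card X" "2 \<le> card (verts G - X)"
    using X(2,3) card_le_Suc0_iff_eq[OF fin(1)] card_le_Suc0_iff_eq[OF fin(2)] by fastforce
  then show ?thesis
  proof cases
    case source
    then show ?thesis
      using card_edge_cut_singleton[OF wf] by simp
  next
    case target
    then have "card (edge_cut G X) = deg G v"
      using card_edge_cut_singleton[OF wf, of v] edge_cut_complement[OF wf X(1)] by metis
    then show ?thesis by simp
  next
    case nontrivial
    then show ?thesis
      using cuts deg_le by linarith
  qed
qed

lemma strongly_Menger_edge_connectedI:
  assumes wf: "wf_graph G" and "verts G \<noteq> {}"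
    and deg: "\<And>v. v \<in> verts G \<Longrightarrow> 0 < deg G v" "\<And>v. v \<in> verts G \<Longrightarrow> deg G v \<le> d"
    and cuts: "\<And>X. X \<subseteq> verts G \<Longrightarrow> 2 \<le> card X \<Longrightarrow> 2 \<le> card (verts G - X) \<Longrightarrow>
      d \<le> card (edge_cut G X)"
  shows "strongly_Menger_edge_connected G"
proof -
  have paths: "edge_disjoint_paths G u v (min (deg G u) (deg G v))"
    if "u \<in> verts G" "v \<in> verts G" "u \<noteq> v" for u v
  proof (rule edge_Menger[OF wf])
    show "u \<in> verts G" "u \<noteq> v" using that by auto
    fix X assume "X \<subseteq> verts G" "u \<in> X" "v \<notin> X"
    then show "min (deg G u) (deg G v) \<le> card (edge_cut G X)"
      using that deg(2) cuts by (intro min_deg_le_edge_cut[OF wf, where d = d]) auto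
  qed
  have "\<exists>p. upath G u v p" if "u \<in> verts G" "v \<in> verts G" for u v
  proof (cases "u = v")
    case True
    then show ?thesis
      using that by (intro exI[of _ "[u]"]) (simp add: upath_def)
  next
    case False
    with that paths deg(1) obtain P where "card P = min (deg G u) (deg G v)" "\<forall>p\<in>P. upath G u v p"
      unfolding edge_disjoint_paths_def by meson
    moreover have "0 < min (deg G u) (deg G v)"
      using deg(1) that by simp
    ultimately show ?thesis
      by (metis card.empty equals0I less_irrefl)
  qed
  then show ?thesis
    using paths assms(2) by (simp add: strongly_Menger_edge_connected_def connected_graph_def)
qed

lemma edge_fault_tolerantI:
  assumes wf: "wf_graph G" and "verts G \<noteq> {}" and reg: "regular d G" and "m < d"
    and cuts: "\<And>X. X \<subseteq> verts G \<Longrightarrow> 2 \<le> card X \<Longrightarrow> 2 \<le> card (verts G - X) \<Longrightarrow>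
      d + m \<le> card (edge_cut G X)"
  shows "edge_fault_tolerant_strongly_Menger m G"
proof -
  have Menger: "strongly_Menger_edge_connected (delete_edges G F)"
    if F: "finite F" "card F \<le> m" for F
  proof (rule strongly_Menger_edge_connectedI)
    let ?H = "delete_edges G F"
    show wfH: "wf_graph ?H"
      using wf by (rule wf_graph_delete_edges)
    show "verts ?H \<noteq> {}"
      using assms(2) by simp
    have cut: "card (edge_cut G X) - m \<le> card (edge_cut ?H X)" for X
      using diff_card_le_card_Diff[OF F(1), of "edge_cut G X"] F(2)
      unfolding edge_cut_delete_edges by linarith
    show "0 < deg ?H v" "deg ?H v \<le> d" if "v \<in> verts ?H" for v
    proof -
      have "deg G v = d"
        using reg that by (simp add: regular_def)
      then show "0 < deg ?H v"
        using cut[of "{v}"] \<open>m < d\<close> by (simp add: card_edge_cut_singleton wf wfH)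
      show "deg ?H v \<le> d"
        unfolding \<open>deg G v = d\<close>[symmetric] deg_def
        using wf_graph_finite_edges[OF wf] by (intro card_mono) auto
    qed
    show "d \<le> card (edge_cut ?H X)"
      if "X \<subseteq> verts ?H" "2 \<le> card X" "2 \<le> card (verts ?H - X)" for X
      using cuts[of X] cut[of X] that by simp
  qed
  have "delete_edges G {} = G"
    by (simp add: delete_edges_def)
  then have "connected_graph G"
    using Menger[of "{}"]
    by (metis card.empty finite.emptyI strongly_Menger_edge_connected_def zero_le)
  then show ?thesis
    using Menger by (simp add: edge_fault_tolerant_strongly_Menger_def)
qed

lemma not_edge_fault_tolerant_if_nonadjacent:
  assumes wf: "wf_graph G" and reg: "regular d G" and uw: "{u, w} \<in> edges G"
    and v: "v \<in> verts G" "v \<noteq> w" "{v, w} \<notin> edges G" and "d \<le> Suc k"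
  shows "\<not> edge_fault_tolerant_strongly_Menger k G"
proof
  assume tolerant: "edge_fault_tolerant_strongly_Menger k G"
  define F where "F = incident (edges G) w - {{u, w}}"
  let ?H = "delete_edges G F"
  note u = wf_graph_edgeD[OF wf uw]
  have fin: "finite (edges G)" using wf_graph_finite_edges[OF wf] .
  have "u \<noteq> v" using uw v by auto
  have deg_eq: "deg G u = d" "deg G v = d" "deg G w = d"
    using reg u v by (auto simp: regular_def)
  have "card F = d - 1"
    using deg_eq(3) uw fin by (simp add: F_def deg_def)
  moreover have "F \<subseteq> edges G" "finite F"
    using fin by (auto simp: F_def)
  ultimately have "strongly_Menger_edge_connected ?H"
    using tolerant \<open>d \<le> Suc k\<close> by (simp add: edge_fault_tolerant_strongly_Menger_def)
  then have "edge_disjoint_paths ?H u v (min (deg ?H u) (deg ?H v))"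
    using u v \<open>u \<noteq> v\<close> by (simp add: strongly_Menger_edge_connected_def)
  moreover have "deg ?H u = d" "deg ?H v = d"
    using deg_delete_edges_at_neighbour[OF wf, of F w] u(3) v(2,3) deg_eq(1,2) by (auto simp: F_def)
  ultimately have "edge_disjoint_paths ?H u v d" by simp
  then have "d \<le> card (edge_cut ?H {u, w})"
    by (rule edge_disjoint_paths_le_edge_cut[OF wf_graph_delete_edges[OF wf]])
      (use v(2) \<open>u \<noteq> v\<close> in auto)
  also have "\<dots> \<le> card (incident (edges G) u - {{u, w}})"
    using fin by (intro card_mono) (auto simp: edge_cut_def F_def)
  also have "\<dots> < card (incident (edges G) u)"
    using fin uw by (intro card_Diff1_less) auto
  finally show False
    using deg_eq(1) by (simp add: deg_def)
qed

subsection \<open>Edge cuts of line graphs\<close>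

lemma verts_line_graph [simp]: "verts (line_graph G) = edges G"
  by (simp add: line_graph_def)

lemma line_graph_edge_iff:
  "{e, e'} \<in> edges (line_graph G) \<longleftrightarrow> e \<in> edges G \<and> e' \<in> edges G \<and> e \<noteq> e' \<and> e \<inter> e' \<noteq> {}"
  by (auto simp: line_graph_def doubleton_eq_iff)

lemma wf_line_graph:
  assumes "wf_graph G"
  shows "wf_graph (line_graph G)"
  using wf_graph_finite_edges[OF assms] by (auto simp: wf_graph_def line_graph_def card_insert_if)

lemma card_Int_edges_le_1:
  assumes "wf_graph G" "e \<in> edges G" "e' \<in> edges G" "e \<noteq> e'"
  shows "card (e \<inter> e') \<le> 1"
proof (rule ccontr)
  have card_edge: "card e = 2" "card e' = 2" "finite e" "finite e'"
    using assms finite_subset by (auto simp: wf_graph_def)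
  assume "\<not> card (e \<inter> e') \<le> 1"
  then have "e \<inter> e' = e" "e \<inter> e' = e'"
    using card_edge by (intro card_seteq; simp)+
  with assms(4) show False by simp
qed

definition crossing_pairs :: "'a ugraph \<Rightarrow> 'a set set \<Rightarrow> 'a \<Rightarrow> nat" where
  "crossing_pairs G X w = card (incident X w) * card (incident (edges G - X) w)"

definition mixed_verts :: "'a ugraph \<Rightarrow> 'a set set \<Rightarrow> 'a set" where
  "mixed_verts G X = {w \<in> verts G. incident X w \<noteq> {} \<and> incident (edges G - X) w \<noteq> {}}"

lemma mixed_verts_complement: "X \<subseteq> edges G \<Longrightarrow> mixed_verts G (edges G - X) = mixed_verts G X"
  by (auto simp: mixed_verts_def)

lemma card_edge_cut_line_graph:
  assumes wf: "wf_graph G" and X: "X \<subseteq> edges G"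
  shows "card (edge_cut (line_graph G) X) = (\<Sum>w\<in>verts G. crossing_pairs G X w)"
proof -
  let ?Y = "edges G - X"
  have fin: "finite (verts G)" "finite X" "finite ?Y"
    using wf wf_graph_finite_edges[OF wf] finite_subset[OF X] by (auto simp: wf_graph_def)
  have adjacent: "of_bool ({e, e'} \<in> edges (line_graph G)) =
      (\<Sum>w\<in>verts G. of_bool (w \<in> e) * (of_bool (w \<in> e') :: nat))" if "e \<in> X" "e' \<in> ?Y" for e e'
  proof -
    have e: "e \<in> edges G" "e' \<in> edges G" "e \<noteq> e'" "e \<inter> e' \<subseteq> verts G"
      using that X wf by (auto simp: wf_graph_def)
    then have "finite (e \<inter> e')"
      using fin(1) finite_subset by blast
    then have "of_bool ({e, e'} \<in> edges (line_graph G)) = card (e \<inter> e')"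
      using e card_Int_edges_le_1[OF wf e(1-3)]
      by (cases "card (e \<inter> e')") (auto simp: line_graph_edge_iff)
    also have "e \<inter> e' = verts G \<inter> {w. w \<in> e \<and> w \<in> e'}"
      using e(4) by blast
    finally show ?thesis
      using fin(1) by (simp flip: of_bool_conj)
  qed
  have incident: "card (incident E w) = (\<Sum>e\<in>E. of_bool (w \<in> e))"
    if "finite E" for E :: "'a set set" and w
    using that by (simp add: Int_def)
  have "card (edge_cut (line_graph G) X) =
      (\<Sum>e\<in>X. \<Sum>e'\<in>?Y. \<Sum>w\<in>verts G. of_bool (w \<in> e) * of_bool (w \<in> e'))"
    using card_edge_cut[OF wf_line_graph[OF wf], of X] X adjacent by simp
  also have "\<dots> = (\<Sum>w\<in>verts G. \<Sum>e\<in>X. \<Sum>e'\<in>?Y. of_bool (w \<in> e) * of_bool (w \<in> e'))"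
    by (simp only: sum.swap[of _ _ "verts G"])
  also have "\<dots> = (\<Sum>w\<in>verts G. crossing_pairs G X w)"
    unfolding crossing_pairs_def incident[OF fin(2)] incident[OF fin(3)] sum_product ..
  finally show ?thesis .
qed

lemma card_edge_cut_line_graph_mixed:
  assumes wf: "wf_graph G" and X: "X \<subseteq> edges G"
  shows "card (edge_cut (line_graph G) X) = (\<Sum>w\<in>mixed_verts G X. crossing_pairs G X w)"
  unfolding card_edge_cut_line_graph[OF assms]
proof (intro sum.mono_neutral_right ballI)
  show "finite (verts G)" "mixed_verts G X \<subseteq> verts G"
    using wf by (auto simp: wf_graph_def mixed_verts_def)
  fix w assume "w \<in> verts G - mixed_verts G X"
  then have "incident X w = {} \<or> incident (edges G - X) w = {}"
    unfolding mixed_verts_def by blast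
  then show "crossing_pairs G X w = 0"
    unfolding crossing_pairs_def by (metis card.empty mult_zero_left mult_zero_right)
qed

lemma card_incident_complement:
  assumes "wf_graph G" "X \<subseteq> edges G"
  shows "card (incident X w) + card (incident (edges G - X) w) = deg G w"
proof -
  have "finite (edges G)"
    using wf_graph_finite_edges[OF assms(1)] .
  then have "card (incident X w \<union> incident (edges G - X) w) =
      card (incident X w) + card (incident (edges G - X) w)"
    using finite_subset[OF assms(2)] by (intro card_Un_disjoint) auto
  moreover have "incident X w \<union> incident (edges G - X) w = incident (edges G) w"
    using assms(2) by auto
  ultimately show ?thesis by (simp add: deg_def)
qed

lemma crossing_pairs_eq:
  assumes "wf_graph G" "X \<subseteq> edges G"
  shows "crossing_pairs G X w = card (incident X w) * (deg G w - card (incident X w))"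
  unfolding crossing_pairs_def card_incident_complement[OF assms, of w, symmetric] by simp

lemma crossing_pairs_mixed_ge:
  assumes wf: "wf_graph G" and X: "X \<subseteq> edges G" and w: "w \<in> mixed_verts G X"
  shows "deg G w - 1 \<le> crossing_pairs G X w"
proof -
  have "0 < card (incident X w)" "0 < card (incident (edges G - X) w)"
    using w wf_graph_finite_edges[OF wf] finite_subset[OF X]
    by (auto simp: mixed_verts_def card_gt_0_iff)
  moreover have "x + y - 1 \<le> x * y" if "0 < x" "0 < y" for x y :: nat
    using that by (cases x; cases y) auto
  ultimately show ?thesis
    using card_incident_complement[OF wf X, of w] by (metis crossing_pairs_def)
qed

lemma deg_line_graph:
  assumes wf: "wf_graph G" and e: "e \<in> edges G"
  shows "deg (line_graph G) e = (\<Sum>w\<in>e. deg G w - 1)"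
proof -
  have "finite (verts G)" "e \<subseteq> verts G"
    using wf e by (auto simp: wf_graph_def)
  have "incident {e} w = (if w \<in> e then {e} else {})" for w by auto
  then have pairs: "crossing_pairs G {e} w = (if w \<in> e then deg G w - 1 else 0)" for w
    using crossing_pairs_eq[OF wf, of "{e}" w] e by simp
  have "deg (line_graph G) e = (\<Sum>w\<in>verts G. crossing_pairs G {e} w)"
    using card_edge_cut_line_graph[OF wf, of "{e}"] e
      card_edge_cut_singleton[OF wf_line_graph[OF wf]] by simp
  also have "\<dots> = (\<Sum>w\<in>e. crossing_pairs G {e} w)"
    using \<open>finite (verts G)\<close> \<open>e \<subseteq> verts G\<close> pairs by (intro sum.mono_neutral_right) auto
  finally show ?thesis
    using pairs by simp
qed

lemma regular_line_graph:
  assumes "wf_graph G" "regular n G"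
  shows "regular (2 * n - 2) (line_graph G)"
  unfolding regular_def
proof
  fix e assume "e \<in> verts (line_graph G)"
  then have e: "e \<in> edges G" "card e = 2" "\<And>w. w \<in> e \<Longrightarrow> deg G w = n"
    using assms by (auto simp: wf_graph_def regular_def)
  then show "deg (line_graph G) e = 2 * n - 2"
    using deg_line_graph[OF assms(1) e(1)] by simp
qed

lemma edges_within_three_vertices:
  assumes wf: "wf_graph G" and X: "X \<subseteq> edges G" "2 \<le> card X"
    and M: "finite M" "card M \<le> 3" "\<And>e. e \<in> X \<Longrightarrow> e \<subseteq> M"
  obtains w where "w \<in> M" "card M = 3" "card (incident X w) = 2"
proof -
  have finX: "finite X"
    using wf_graph_finite_edges[OF wf] finite_subset[OF X(1)] by blast
  then obtain e e' where e: "e \<in> X" "e' \<in> X" "e \<noteq> e'"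
    using X(2) card_le_Suc0_iff_eq[of X] by auto
  have edge: "card d = 2" "finite d" if "d \<in> X" for d
    using that X(1) M(1,3) wf finite_subset[of d M] by (auto simp: wf_graph_def)
  have "card (e \<union> e') \<le> card M"
    using M e by (intro card_mono) auto
  moreover have "card (e \<union> e') + card (e \<inter> e') = 4"
    using card_Un_Int[of e e'] edge e by simp
  moreover have "card (e \<inter> e') \<le> 1"
    using card_Int_edges_le_1[OF wf] X(1) e by blast
  ultimately have card_M: "card M = 3" and "card (e \<inter> e') \<noteq> 0"
    using M(2) by linarith+
  then obtain w where w: "w \<in> e" "w \<in> e'"
    by (metis card.empty disjoint_iff)
  with M(3) e have "w \<in> M" by blast
  have "card (incident X w) < 3"
    using card_incident_less[OF M(1) \<open>w \<in> M\<close>, of X] M(3) edge card_M by simp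
  moreover have "card {e, e'} \<le> card (incident X w)"
    using e w finX by (intro card_mono) auto
  ultimately have "card (incident X w) = 2"
    using e by simp
  with that \<open>w \<in> M\<close> card_M show ?thesis by blast
qed

lemma line_graph_cut_few_mixed:
  assumes wf: "wf_graph G" and reg: "regular n G" and X: "X \<subseteq> edges G" "2 \<le> card X"
    and few: "card (mixed_verts G X) \<le> 3"
    and complement: "\<And>w. w \<in> verts G \<Longrightarrow> incident (edges G - X) w \<noteq> {}"
  shows "4 * n - 6 \<le> card (edge_cut (line_graph G) X)"
proof -
  let ?M = "mixed_verts G X"
  have fin: "finite ?M"
    using wf by (simp add: mixed_verts_def wf_graph_def)
  have "e \<subseteq> ?M" if "e \<in> X" for e
    using that X(1) complement wf unfolding mixed_verts_def wf_graph_def by blast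
  with wf X fin few obtain w where w: "w \<in> ?M" "card ?M = 3" "card (incident X w) = 2"
    by (rule edges_within_three_vertices)
  have deg: "deg G v = n" if "v \<in> ?M" for v
    using that reg by (simp add: mixed_verts_def regular_def)
  have "2 * (n - 1) = (\<Sum>v\<in>?M - {w}. n - 1)"
    using w fin by simp
  also have "\<dots> \<le> (\<Sum>v\<in>?M - {w}. crossing_pairs G X v)"
    using crossing_pairs_mixed_ge[OF wf X(1)] deg by (intro sum_mono) fastforce
  finally have "2 * (n - 1) + 2 * (n - 2) \<le>
      (\<Sum>v\<in>?M - {w}. crossing_pairs G X v) + crossing_pairs G X w"
    using crossing_pairs_eq[OF wf X(1), of w] w(3) deg[OF w(1)] by simp
  also have "\<dots> = card (edge_cut (line_graph G) X)"
    using card_edge_cut_line_graph_mixed[OF wf X(1)]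
      sum.remove[OF fin w(1), of "crossing_pairs G X"] by simp
  finally show ?thesis by linarith
qed

definition separated_pair :: "'a ugraph \<Rightarrow> 'a set \<Rightarrow> 'a set \<Rightarrow> bool" where
  "separated_pair G A B \<longleftrightarrow> A \<subseteq> verts G \<and> B \<subseteq> verts G \<and> A \<noteq> {} \<and> B \<noteq> {} \<and> A \<inter> B = {} \<and>
     (\<forall>a\<in>A. \<forall>b\<in>B. {a, b} \<notin> edges G)"

text \<open>Complete graphs have no separated pair, so they count as \<open>k\<close>-connected for every \<open>k\<close>.\<close>

definition vertex_connected :: "nat \<Rightarrow> 'a ugraph \<Rightarrow> bool" where
  "vertex_connected k G \<longleftrightarrow> (\<forall>A B. separated_pair G A B \<longrightarrow> k \<le> card (verts G - (A \<union> B)))"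

lemma few_mixed_verts_one_sided:
  assumes wf: "wf_graph G" and "vertex_connected k G" and X: "X \<subseteq> edges G"
    and deg: "\<And>w. w \<in> verts G \<Longrightarrow> 0 < deg G w" and few: "card (mixed_verts G X) < k"
  shows "(\<forall>w\<in>verts G. incident X w \<noteq> {}) \<or> (\<forall>w\<in>verts G. incident (edges G - X) w \<noteq> {})"
proof -
  define A where "A = {w \<in> verts G. incident X w = {}}"
  define B where "B = {w \<in> verts G. incident (edges G - X) w = {}}"
  have "verts G - (A \<union> B) = mixed_verts G X"
    by (auto simp: A_def B_def mixed_verts_def)
  then have "\<not> separated_pair G A B"
    using assms(2) few unfolding vertex_connected_def by (metis not_less)
  moreover have "A \<subseteq> verts G" "B \<subseteq> verts G"
    unfolding A_def B_def by blast+
  moreover have "{a, b} \<notin> edges G" if "a \<in> A" "b \<in> B" for a b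
    using that unfolding A_def B_def by blast
  moreover have "A \<inter> B = {}"
  proof (rule equals0I)
    fix w assume "w \<in> A \<inter> B"
    then have "incident X w = {}" "incident (edges G - X) w = {}" "w \<in> verts G"
      unfolding A_def B_def by blast+
    then show False
      using card_incident_complement[OF wf X, of w] deg[of w]
      by (metis add_0 card.empty less_irrefl)
  qed
  ultimately have "A = {} \<or> B = {}"
    unfolding separated_pair_def by blast
  then show ?thesis
    unfolding A_def B_def by blast
qed

lemma card_mixed_verts_le_line_graph_cut:
  assumes wf: "wf_graph G" and reg: "regular n G" and X: "X \<subseteq> edges G"
  shows "card (mixed_verts G X) * (n - 1) \<le> card (edge_cut (line_graph G) X)"
proof -
  have "n - 1 \<le> crossing_pairs G X w" if "w \<in> mixed_verts G X" for w
    using crossing_pairs_mixed_ge[OF wf X that] reg that by (simp add: mixed_verts_def regular_def)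
  then have "(\<Sum>w\<in>mixed_verts G X. n - 1) \<le> (\<Sum>w\<in>mixed_verts G X. crossing_pairs G X w)"
    by (rule sum_mono)
  then show ?thesis
    using card_edge_cut_line_graph_mixed[OF wf X] by simp
qed

lemma line_graph_nontrivial_cut:
  assumes wf: "wf_graph G" and reg: "regular n G" and conn: "vertex_connected n G" and "3 \<le> n"
    and X: "X \<subseteq> edges G" "2 \<le> card X" "2 \<le> card (edges G - X)"
  shows "4 * n - 6 \<le> card (edge_cut (line_graph G) X)"
proof (cases "card (mixed_verts G X) \<le> 3 \<and> card (mixed_verts G X) < n")
  case True
  have "0 < deg G w" if "w \<in> verts G" for w
    using that reg \<open>3 \<le> n\<close> by (simp add: regular_def)
  with True consider (X_covers) "\<And>w. w \<in> verts G \<Longrightarrow> incident X w \<noteq> {}"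
    | (complement_covers) "\<And>w. w \<in> verts G \<Longrightarrow> incident (edges G - X) w \<noteq> {}"
    using few_mixed_verts_one_sided[OF wf conn X(1)] by blast
  then show ?thesis
  proof cases
    case X_covers
    have "edges G - (edges G - X) = X" using X(1) by blast
    then have "4 * n - 6 \<le> card (edge_cut (line_graph G) (edges G - X))"
      using X_covers True X
      by (intro line_graph_cut_few_mixed[OF wf reg]) (auto simp: mixed_verts_complement)
    then show ?thesis
      using edge_cut_complement[OF wf_line_graph[OF wf], of X] X(1) by simp
  next
    case complement_covers
    then show ?thesis
      using True X by (intro line_graph_cut_few_mixed[OF wf reg]) auto
  qed
next
  case False
  then consider (four) "4 \<le> card (mixed_verts G X)" | (cubic) "n = 3" "card (mixed_verts G X) = 3"
    using \<open>3 \<le> n\<close> by linarith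
  then have "4 * n - 6 \<le> card (mixed_verts G X) * (n - 1)"
  proof cases
    case four
    then have "4 * (n - 1) \<le> card (mixed_verts G X) * (n - 1)" by (rule mult_le_mono1)
    then show ?thesis by linarith
  qed simp
  also have "\<dots> \<le> card (edge_cut (line_graph G) X)"
    using card_mixed_verts_le_line_graph_cut[OF wf reg X(1)] .
  finally show ?thesis .
qed

lemma regular_disjoint_edge:
  assumes wf: "wf_graph G" and reg: "regular n G" and "3 \<le> n" and e: "e \<in> edges G"
  obtains e' where "e' \<in> edges G" "e \<inter> e' = {}"
proof -
  have edge: "card e = 2" "e \<subseteq> verts G" "finite e"
    using wf e finite_subset by (auto simp: wf_graph_def)
  then obtain x where "x \<in> verts G" by (auto simp: card_2_iff)
  then have "2 < card (verts G)"
    using deg_less_card_verts[OF wf, of x] reg \<open>3 \<le> n\<close> by (simp add: regular_def)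
  then have "\<not> verts G \<subseteq> e"
    using card_mono[of e "verts G"] edge by auto
  then obtain y where y: "y \<in> verts G" "y \<notin> e" by blast
  have "\<exists>e'\<in>edges G. y \<in> e' \<and> e \<inter> e' = {}"
  proof (rule ccontr)
    assume meet: "\<not> (\<exists>e'\<in>edges G. y \<in> e' \<and> e \<inter> e' = {})"
    have "card (incident (edges G) y) < card (insert y e)"
    proof (rule card_incident_less)
      fix e' assume e': "e' \<in> edges G" "y \<in> e'"
      then obtain z where z: "e' = {y, z}"
        using wf_graph_edgeE[OF wf] by blast
      have "e \<inter> e' \<noteq> {}" using meet e' by blast
      with y(2) have "z \<in> e" by (simp add: z)
      moreover have "card e' = 2" using e'(1) wf by (simp add: wf_graph_def)
      ultimately show "e' \<subseteq> insert y e \<and> card e' = 2" by (simp add: z)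
    qed (simp_all add: edge(3))
    also have "\<dots> = 3" using y(2) edge by simp
    finally have "deg G y < 3" unfolding deg_def .
    then show False
      using y(1) reg \<open>3 \<le> n\<close> by (simp add: regular_def)
  qed
  with that show ?thesis by blast
qed

lemma line_graph_nonadjacent:
  assumes wf: "wf_graph G" and "verts G \<noteq> {}" and reg: "regular n G" and "3 \<le> n"
  obtains u v w where "{u, w} \<in> edges (line_graph G)" "v \<in> edges G" "v \<noteq> w"
    "{v, w} \<notin> edges (line_graph G)"
proof -
  obtain x where "x \<in> verts G" using assms(2) by blast
  then obtain w where w: "w \<in> edges G"
    using regular_incident_edge[OF reg] \<open>3 \<le> n\<close> by (metis not_numeral_le_zero)
  then obtain c where "c \<in> edges (line_graph G)" "w \<in> c"
    using regular_incident_edge[OF regular_line_graph[OF wf reg], of w] \<open>3 \<le> n\<close> by auto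
  then obtain u where uw: "{u, w} \<in> edges (line_graph G)"
    using wf_graph_edgeE[OF wf_line_graph[OF wf]] by (metis insert_commute)
  obtain v where v: "v \<in> edges G" "w \<inter> v = {}"
    using regular_disjoint_edge[OF wf reg \<open>3 \<le> n\<close> w] .
  moreover have "w \<noteq> {}"
    using w wf by (auto simp: wf_graph_def)
  ultimately show ?thesis
    by (intro that[OF uw v(1)]) (auto simp: line_graph_edge_iff)
qed

theorem edge_fault_tolerant_line_graph_iff:
  assumes wf: "wf_graph G" and "verts G \<noteq> {}" and reg: "regular n G" and "3 \<le> n"
    and conn: "vertex_connected n G"
  shows "edge_fault_tolerant_strongly_Menger k (line_graph G) \<longleftrightarrow> k \<le> 2 * n - 4"
proof -
  note wfL = wf_line_graph[OF wf] and regL = regular_line_graph[OF wf reg]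
  obtain u v w where uw: "{u, w} \<in> edges (line_graph G)"
    and v: "v \<in> edges G" "v \<noteq> w" "{v, w} \<notin> edges (line_graph G)"
    by (rule line_graph_nonadjacent[OF wf assms(2) reg \<open>3 \<le> n\<close>])
  show ?thesis
  proof
    assume "edge_fault_tolerant_strongly_Menger k (line_graph G)"
    then have "\<not> 2 * n - 2 \<le> Suc k"
      using not_edge_fault_tolerant_if_nonadjacent[OF wfL regL uw] v by auto
    then show "k \<le> 2 * n - 4" by linarith
  next
    assume "k \<le> 2 * n - 4"
    show "edge_fault_tolerant_strongly_Menger k (line_graph G)"
    proof (rule edge_fault_tolerantI[OF wfL _ regL])
      show "verts (line_graph G) \<noteq> {}" using v(1) by auto
      show "k < 2 * n - 2" using \<open>3 \<le> n\<close> \<open>k \<le> 2 * n - 4\<close> by linarith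
      fix X assume "X \<subseteq> verts (line_graph G)" "2 \<le> card X" "2 \<le> card (verts (line_graph G) - X)"
      then have "4 * n - 6 \<le> card (edge_cut (line_graph G) X)"
        using line_graph_nontrivial_cut[OF wf reg conn \<open>3 \<le> n\<close>] by simp
      then show "2 * n - 2 + k \<le> card (edge_cut (line_graph G) X)"
        using \<open>3 \<le> n\<close> \<open>k \<le> 2 * n - 4\<close> by linarith
    qed
  qed
qed

subsection \<open>Hypercube-like networks\<close>

locale graph_join =
  fixes Q\<^sub>1 :: "'a ugraph" and f :: "'a \<Rightarrow> 'a" and Q\<^sub>2 :: "'a ugraph"
  assumes wf: "wf_graph Q\<^sub>1" "wf_graph Q\<^sub>2"
    and disjoint: "verts Q\<^sub>1 \<inter> verts Q\<^sub>2 = {}"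
    and bij: "bij_betw f (verts Q\<^sub>1) (verts Q\<^sub>2)"
begin

abbreviation Q :: "'a ugraph" where
  "Q \<equiv> join_by Q\<^sub>1 f Q\<^sub>2"

lemma graph_join_flip: "graph_join Q\<^sub>2 (inv_into (verts Q\<^sub>1) f) Q\<^sub>1"
  using wf disjoint bij_betw_inv_into[OF bij] by unfold_locales auto

lemma join_by_flip: "join_by Q\<^sub>2 (inv_into (verts Q\<^sub>1) f) Q\<^sub>1 = Q"
proof -
  let ?g = "inv_into (verts Q\<^sub>1) f"
  have "\<exists>u\<in>verts Q\<^sub>1. {v, ?g v} = {u, f u}" if "v \<in> verts Q\<^sub>2" for v
    using that bij_betw_apply[OF bij_betw_inv_into[OF bij]] bij_betw_inv_into_right[OF bij]
    by (intro bexI[of _ "?g v"]) auto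
  moreover have "\<exists>u\<in>verts Q\<^sub>2. {v, f v} = {u, ?g u}" if "v \<in> verts Q\<^sub>1" for v
    using that bij_betw_apply[OF bij] bij_betw_inv_into_left[OF bij]
    by (intro bexI[of _ "f v"]) auto
  ultimately have "{{v, ?g v} | v. v \<in> verts Q\<^sub>2} = {{v, f v} | v. v \<in> verts Q\<^sub>1}"
    by blast
  then show ?thesis
    by (simp add: join_by_def Un_ac)
qed

lemma verts_join: "verts Q = verts Q\<^sub>1 \<union> verts Q\<^sub>2"
  by (simp add: join_by_def)

lemma match_mem: "v \<in> verts Q\<^sub>1 \<Longrightarrow> f v \<in> verts Q\<^sub>2"
  using bij by (rule bij_betw_apply)

lemma match_edge: "v \<in> verts Q\<^sub>1 \<Longrightarrow> {v, f v} \<in> edges Q"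
  by (auto simp: join_by_def)

lemma wf_join: "wf_graph Q"
proof -
  have "card {v, f v} = 2" if "v \<in> verts Q\<^sub>1" for v
    using match_mem[OF that] that disjoint by (metis IntI card_2_iff empty_iff)
  then show ?thesis
    using wf match_mem unfolding wf_graph_def join_by_def by auto
qed

lemma deg_join_left:
  assumes v: "v \<in> verts Q\<^sub>1"
  shows "deg Q v = Suc (deg Q\<^sub>1 v)"
proof -
  have "e \<subseteq> verts Q\<^sub>1" if "e \<in> edges Q\<^sub>1" for e
    using that wf by (simp add: wf_graph_def)
  then have "{v, f v} \<notin> edges Q\<^sub>1"
    using match_mem[OF v] disjoint by blast
  moreover have "v \<notin> e" if "e \<in> edges Q\<^sub>2" for e
    using that v wf(2) disjoint unfolding wf_graph_def by blast
  then have "incident (edges Q) v = insert {v, f v} (incident (edges Q\<^sub>1) v)"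
    using v match_mem disjoint by (auto simp: join_by_def)
  ultimately show ?thesis
    using wf_graph_finite_edges[OF wf(1)] by (simp add: deg_def)
qed

lemma regular_join:
  assumes "regular n Q\<^sub>1" "regular n Q\<^sub>2"
  shows "regular (Suc n) Q"
  using assms deg_join_left graph_join.deg_join_left[OF graph_join_flip] verts_join
  by (auto simp: regular_def join_by_flip)

lemma separated_pair_match:
  assumes "separated_pair Q A B" "v \<in> verts Q\<^sub>1"
  shows "\<not> (v \<in> A \<and> f v \<in> B)" "\<not> (v \<in> B \<and> f v \<in> A)"
  using assms(1) match_edge[OF assms(2)] unfolding separated_pair_def
  by (blast, metis insert_commute)

lemma separated_pair_left:
  assumes "separated_pair Q A B" "A \<inter> verts Q\<^sub>1 \<noteq> {}" "B \<inter> verts Q\<^sub>1 \<noteq> {}"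
  shows "separated_pair Q\<^sub>1 (A \<inter> verts Q\<^sub>1) (B \<inter> verts Q\<^sub>1)"
  using assms by (auto simp: separated_pair_def join_by_def)

lemma card_separator_left:
  assumes AB: "separated_pair Q A B" "A \<inter> verts Q\<^sub>1 \<noteq> {}" "B \<inter> verts Q\<^sub>1 \<noteq> {}"
    and conn: "vertex_connected k Q\<^sub>1"
  shows "k \<le> card (verts Q\<^sub>1 - (A \<union> B))"
proof -
  have "verts Q\<^sub>1 - (A \<inter> verts Q\<^sub>1 \<union> B \<inter> verts Q\<^sub>1) = verts Q\<^sub>1 - (A \<union> B)" by blast
  then show ?thesis
    using conn separated_pair_left[OF AB] unfolding vertex_connected_def by metis
qed

lemma card_separator_split:
  "card (verts Q - S) = card (verts Q\<^sub>1 - S) + card (verts Q\<^sub>2 - S)"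
proof -
  have "finite (verts Q\<^sub>1)" "finite (verts Q\<^sub>2)"
    using wf by (simp_all add: wf_graph_def)
  then show ?thesis
    using disjoint by (auto simp: verts_join Un_Diff intro: card_Un_disjoint)
qed

lemma card_separator_meets_left:
  assumes AB: "separated_pair Q A B" "A \<inter> verts Q\<^sub>1 \<noteq> {}" "B \<inter> verts Q\<^sub>1 \<noteq> {}"
    and conn: "vertex_connected k Q\<^sub>1" "vertex_connected k Q\<^sub>2" and "0 < k"
  shows "Suc k \<le> card (verts Q - (A \<union> B))"
proof -
  have "0 < card (verts Q\<^sub>2 - (A \<union> B))"
  proof (cases "A \<inter> verts Q\<^sub>2 \<noteq> {} \<and> B \<inter> verts Q\<^sub>2 \<noteq> {}")
    case True
    then show ?thesis
      using graph_join.card_separator_left[OF graph_join_flip] AB(1) conn(2) \<open>0 < k\<close>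
      unfolding join_by_flip by (metis less_le_trans)
  next
    case False
    obtain a b where "a \<in> A \<inter> verts Q\<^sub>1" "b \<in> B \<inter> verts Q\<^sub>1" using AB by blast
    with False match_mem separated_pair_match[OF AB(1)]
    have "f a \<in> verts Q\<^sub>2 - (A \<union> B) \<or> f b \<in> verts Q\<^sub>2 - (A \<union> B)" by blast
    then show ?thesis
      using wf by (auto simp: card_gt_0_iff wf_graph_def)
  qed
  then show ?thesis
    using card_separator_left[OF AB conn(1)] by (simp add: card_separator_split)
qed

lemma card_separator_matching:
  assumes AB: "separated_pair Q A B"
    and "A \<inter> verts Q\<^sub>1 = {} \<or> B \<inter> verts Q\<^sub>1 = {}" "A \<inter> verts Q\<^sub>2 = {} \<or> B \<inter> verts Q\<^sub>2 = {}"
  shows "card (verts Q\<^sub>1) \<le> card (verts Q - (A \<union> B))"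
proof -
  have fin: "finite (verts Q\<^sub>1)" "finite (verts Q\<^sub>2)"
    using wf by (simp_all add: wf_graph_def)
  have "A \<noteq> {}" "B \<noteq> {}" "A \<subseteq> verts Q\<^sub>1 \<union> verts Q\<^sub>2" "B \<subseteq> verts Q\<^sub>1 \<union> verts Q\<^sub>2"
    using AB by (auto simp: separated_pair_def verts_join)
  with assms(2,3) have "A \<inter> verts Q\<^sub>2 = {} \<and> B \<inter> verts Q\<^sub>1 = {} \<or>
      A \<inter> verts Q\<^sub>1 = {} \<and> B \<inter> verts Q\<^sub>2 = {}"
    by blast
  then have "f v \<in> verts Q\<^sub>2 - (A \<union> B)" if "v \<in> verts Q\<^sub>1 \<inter> (A \<union> B)" for v
    using that match_mem[of v] separated_pair_match[OF AB, of v] by blast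
  then have "card (verts Q\<^sub>1 \<inter> (A \<union> B)) \<le> card (verts Q\<^sub>2 - (A \<union> B))"
    using fin bij by (intro card_inj_on_le[of f]) (auto simp: bij_betw_def intro: inj_on_subset)
  moreover have "card (verts Q\<^sub>1) = card (verts Q\<^sub>1 \<inter> (A \<union> B)) + card (verts Q\<^sub>1 - (A \<union> B))"
    using card_Int_Diff[OF fin(1)] .
  ultimately show ?thesis
    by (simp add: card_separator_split)
qed

lemma vertex_connected_join:
  assumes conn: "vertex_connected k Q\<^sub>1" "vertex_connected k Q\<^sub>2" and "0 < k" "k < card (verts Q\<^sub>1)"
  shows "vertex_connected (Suc k) Q"
  unfolding vertex_connected_def
proof (intro allI impI)
  fix A B assume AB: "separated_pair Q A B"
  consider (left) "A \<inter> verts Q\<^sub>1 \<noteq> {}" "B \<inter> verts Q\<^sub>1 \<noteq> {}"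
    | (right) "A \<inter> verts Q\<^sub>2 \<noteq> {}" "B \<inter> verts Q\<^sub>2 \<noteq> {}"
    | (neither) "A \<inter> verts Q\<^sub>1 = {} \<or> B \<inter> verts Q\<^sub>1 = {}" "A \<inter> verts Q\<^sub>2 = {} \<or> B \<inter> verts Q\<^sub>2 = {}"
    by blast
  then show "Suc k \<le> card (verts Q - (A \<union> B))"
  proof cases
    case left
    then show ?thesis
      using card_separator_meets_left[OF AB] conn \<open>0 < k\<close> by blast
  next
    case right
    then show ?thesis
      using graph_join.card_separator_meets_left[OF graph_join_flip] AB conn \<open>0 < k\<close>
      unfolding join_by_flip by blast
  next
    case neither
    then show ?thesis
      using card_separator_matching[OF AB] assms(4) by linarith
  qed
qed

end

lemma hypercube_like_wf: "hypercube_like n Q \<Longrightarrow> wf_graph Q"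
proof (induction rule: hypercube_like.induct)
  case (K2 a b)
  then show ?case by (simp add: wf_graph_def)
next
  case (join n Q\<^sub>1 Q\<^sub>2 f)
  then interpret graph_join Q\<^sub>1 f Q\<^sub>2 by unfold_locales
  show ?case by (rule wf_join)
qed

lemma hypercube_like_verts_nonempty: "hypercube_like n Q \<Longrightarrow> verts Q \<noteq> {}"
  by (induction rule: hypercube_like.induct) (auto simp: join_by_def)

lemma hypercube_like_dim_pos: "hypercube_like n Q \<Longrightarrow> 0 < n"
  by (induction rule: hypercube_like.induct) auto

lemma graph_join_hypercube_like:
  assumes "hypercube_like n Q\<^sub>1" "hypercube_like n Q\<^sub>2" "verts Q\<^sub>1 \<inter> verts Q\<^sub>2 = {}"
    "bij_betw f (verts Q\<^sub>1) (verts Q\<^sub>2)"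
  shows "graph_join Q\<^sub>1 f Q\<^sub>2"
  using assms hypercube_like_wf by unfold_locales

lemma hypercube_like_regular: "hypercube_like n Q \<Longrightarrow> regular n Q"
proof (induction rule: hypercube_like.induct)
  case (K2 a b)
  have "incident {{a, b}} v = {{a, b}}" if "v \<in> {a, b}" for v using that by auto
  then show ?case by (simp add: regular_def deg_def)
next
  case (join n Q\<^sub>1 Q\<^sub>2 f)
  then show ?case
    by (intro graph_join.regular_join graph_join_hypercube_like)
qed

lemma hypercube_like_vertex_connected: "hypercube_like n Q \<Longrightarrow> vertex_connected n Q"
proof (induction rule: hypercube_like.induct)
  case (K2 a b)
  have "\<not> separated_pair \<lparr>verts = {a, b}, edges = {{a, b}}\<rparr> A B" for A B
  proof
    assume AB: "separated_pair \<lparr>verts = {a, b}, edges = {{a, b}}\<rparr> A B"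
    then have "a \<in> A \<and> b \<in> B \<or> b \<in> A \<and> a \<in> B"
      by (auto simp: separated_pair_def)
    with AB show False
      by (auto simp: separated_pair_def insert_commute)
  qed
  then show ?case by (simp add: vertex_connected_def)
next
  case (join n Q\<^sub>1 Q\<^sub>2 f)
  obtain v where "v \<in> verts Q\<^sub>1"
    using hypercube_like_verts_nonempty[OF join.hyps(1)] by blast
  then have "n < card (verts Q\<^sub>1)"
    using deg_less_card_verts[OF hypercube_like_wf[OF join.hyps(1)]]
      hypercube_like_regular[OF join.hyps(1)] by (auto simp: regular_def)
  with join show ?case
    by (intro graph_join.vertex_connected_join graph_join_hypercube_like hypercube_like_dim_pos)
qed

theorem theorem3p3:
  fixes n :: nat and Q :: "'a ugraph"
  assumes "n \<ge> 3" and "hypercube_like n Q"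
  shows "edge_fault_tolerant_strongly_Menger (2 * n - 4) (line_graph Q) \<and>
         (\<forall>k. k > 2 * n - 4 \<longrightarrow> \<not> edge_fault_tolerant_strongly_Menger k (line_graph Q))"
proof -
  have "edge_fault_tolerant_strongly_Menger k (line_graph Q) \<longleftrightarrow> k \<le> 2 * n - 4" for k
    using assms
    by (intro edge_fault_tolerant_line_graph_iff hypercube_like_wf hypercube_like_verts_nonempty
        hypercube_like_regular hypercube_like_vertex_connected)
  then show ?thesis by simp
qed

end
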